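(* Let $N\ge 2$ be an integer and let $R_N$ be the equivalence relation on $[0,1]$ (with Lebesgue measure $\lambda$) given by $(x,y)\in R_N$ iff there exists $f\in F(N)$ with $f(x)=y$. Then $R_N$ is a standard, quasi-preserving, ergodic equivalence relation.
   Context: For an integer $N\ge 2$, an $N$-adic rational is a number $k/N^m$ with $k,m\in\mathbb{Z}$. The generalized Thompson group $F(N)$ is the group (under composition) of piecewise linear homeomorphisms $f:[0,1]\to[0,1]$ that are differentiable except at finitely many points, all of which are $N$-adic rationals, and whose derivatives on intervals of differentiability are (integer) powers of $N$. Let $R$ be an equivalence relation on a standard probability space $(X,\lambda)$. - $R$ is standard if almost every orbit $R[x]=\{y:(x,y)\in R\}$ is at most countable and $R$ is a Borel subset of $X\times X$. - $R$ is quasi-preserving if the saturation $\{y : \exists x\in A,\ (x,y)\in R\}$ of every null set $A$ is null. - $R$ is ergodic if every $R$-saturated Borel set (i.e. a Borel set that is a union of $R$-classes) has measure $0$ or $1$. *)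

theory Defs
  imports "HOL-Analysis.Analysis"
begin

definition nadic_rationals :: "nat \<Rightarrow> real set" where
  "nadic_rationals N = {of_int k / real N powi m | k m :: int. True}"

text \<open>No continuity is built in, and the values at the finitely many breakpoints are unconstrained;
  continuity across them comes from the homeomorphism condition below.\<close>

definition piecewise_linear_on :: "real \<Rightarrow> real \<Rightarrow> (real \<Rightarrow> real) \<Rightarrow> bool" where
  "piecewise_linear_on a b f \<longleftrightarrow>
     (\<exists>S. finite S \<and>
        (\<forall>u v. a \<le> u \<and> u < v \<and> v \<le> b \<and> {u<..<v} \<inter> S = {} \<longrightarrow>
           (\<exists>m c. \<forall>x\<in>{u<..<v}. f x = m * x + c)))"

text \<open>Underlying set of the group. A map from the unit interval to itself is represented by a
  function on the reals that is \<open>undefined\<close> outside the interval, so that equality of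
  representatives is equality of maps. Derivatives at the endpoints are one-sided.\<close>

definition thompson_F :: "nat \<Rightarrow> (real \<Rightarrow> real) set" where
  "thompson_F N = {f \<in> extensional {0..1}.
     (\<exists>g. homeomorphism {0..1} {0..1} f g) \<and>
     piecewise_linear_on 0 1 f \<and>
     finite {x \<in> {0..1}. \<not> f differentiable (at x within {0..1})} \<and>
     {x \<in> {0..1}. \<not> f differentiable (at x within {0..1})} \<subseteq> nadic_rationals N \<and>
     (\<forall>x\<in>{0..1}. f differentiable (at x within {0..1}) \<longrightarrow>
        (\<exists>k::int. (f has_real_derivative (real N powi k)) (at x within {0..1})))}"

definition thompson_orbit_rel :: "nat \<Rightarrow> (real \<times> real) set" where
  "thompson_orbit_rel N =
     {(x, y). x \<in> {0..1} \<and> y \<in> {0..1} \<and> (\<exists>f\<in>thompson_F N. f x = y)}"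

text \<open>In the following notions \<open>M\<close> is a Borel probability measure, i.e. its measurable sets
  are the Borel sets of the underlying standard Borel space.\<close>

definition standard_rel :: "'a measure \<Rightarrow> ('a \<times> 'a) set \<Rightarrow> bool" where
  "standard_rel M R \<longleftrightarrow> (AE x in M. countable (R `` {x})) \<and> R \<in> sets (M \<Otimes>\<^sub>M M)"

text \<open>Null sets are arbitrary (not necessarily Borel) sets of measure zero, hence the completion.\<close>

definition quasi_preserving_rel :: "'a measure \<Rightarrow> ('a \<times> 'a) set \<Rightarrow> bool" where
  "quasi_preserving_rel M R \<longleftrightarrow>
     (\<forall>A \<in> null_sets (completion M). R `` A \<in> null_sets (completion M))"

definition ergodic_rel :: "'a measure \<Rightarrow> ('a \<times> 'a) set \<Rightarrow> bool" where
  "ergodic_rel M R \<longleftrightarrow>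
     (\<forall>A \<in> sets M. (\<exists>C \<subseteq> space M // R. A = \<Union>C) \<longrightarrow> emeasure M A = 0 \<or> emeasure M A = 1)"

text \<open>Lebesgue measure on the Borel subsets of the unit interval.\<close>

definition unit_lebesgue :: "real measure" where
  "unit_lebesgue = restrict_space lborel {0..1}"

end

theory Submission
  imports Defs
begin

text \<open>
  On an interval without breakpoints an element of the group is differentiable with derivative in a
  countable set, so its difference quotients, which form a connected subset of that set, are
  constant. Starting at \<open>0\<close> one sees inductively that breakpoints are mapped to \<open>N\<close>-adic
  rationals, hence every affine piece has the form \<open>x \<mapsto> N\<^sup>k x + c\<close> with \<open>c\<close>
  \<open>N\<close>-adic. There are only countably many such maps, which gives countable orbits, a
  Borel relation and quasi-preservation.

  For ergodicity, \<open>x \<mapsto> min (N x, x + (N - 1) p, 1 - (1 - x) / N)\<close> with \<open>p = N\<^bsup>-m\<^esup>\<close>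
  belongs to the group and translates \<open>[p, 1 - N p]\<close> by \<open>(N - 1) p\<close>. For a saturated
  Borel set \<open>A\<close> the function \<open>F(x) = \<lambda>(A \<inter> [0, x])\<close> therefore has equal increments over
  adjacent intervals of length \<open>(N - 1) p\<close>, so letting \<open>m \<rightarrow> \<infinity>\<close> it is linear. Thus
  \<open>\<lambda>(A \<inter> B) = \<lambda>(A) \<lambda>(B)\<close> for all Borel \<open>B\<close>, and \<open>B = A\<close> gives \<open>\<lambda>(A) \<in> {0, 1}\<close>.
\<close>

section \<open>Affine pieces of elements of the Thompson group\<close>

text \<open>By the mean value theorem every difference quotient based at \<open>u\<close> is a
  derivative at an interior point, hence lies in \<open>P\<close>. The quotient is continuous on
  \<open>{u<..v}\<close>, so its range is connected; a connected countable set of reals has at most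
  one point.\<close>

lemma affine_if_countable_derivative:
  fixes f :: "real \<Rightarrow> real"
  assumes uv: "u < v" and cont: "continuous_on {u..v} f" and P: "countable P"
    and der: "\<And>x. u < x \<Longrightarrow> x < v \<Longrightarrow> \<exists>d\<in>P. (f has_real_derivative d) (at x)"
  shows "\<exists>d\<in>P. \<forall>x\<in>{u..v}. f x = f u + d * (x - u)"
proof -
  define q where "q x = (f x - f u) / (x - u)" for x
  have q_P: "q x \<in> P" if x: "x \<in> {u<..v}" for x
  proof -
    have "continuous_on {u..x} f"
      using cont by (rule continuous_on_subset) (use x in auto)
    moreover have "f differentiable (at z)" if "u < z" "z < x" for z
      using der[of z] that x by (auto simp: real_differentiable_def)
    ultimately obtain l z where z: "u < z" "z < x"
      and l: "(f has_real_derivative l) (at z)" "f x - f u = (x - u) * l"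
      using MVT[of u x f] x by auto
    from der[of z] z x obtain d where d: "d \<in> P" "(f has_real_derivative d) (at z)"
      by auto
    have "d = l"
      using DERIV_unique[OF d(2) l(1)] .
    then show ?thesis
      using d(1) l(2) x by (simp add: q_def)
  qed
  have "continuous_on {u<..v} q"
    unfolding q_def
    by (intro continuous_intros continuous_on_subset[OF cont]) auto
  then have "connected (q ` {u<..v})"
    by (intro connected_continuous_image) auto
  moreover have "countable (q ` {u<..v})"
    by (rule countable_subset[OF _ P]) (use q_P in auto)
  ultimately have const: "q x = q v" if "x \<in> {u<..v}" for x
    using connected_uncountable[of "q ` {u<..v}" "q x" "q v"] that uv by auto
  show ?thesis
  proof (intro bexI[of _ "q v"] ballI)
    show "q v \<in> P"
      using q_P uv by auto
    fix x assume x: "x \<in> {u..v}"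
    show "f x = f u + q v * (x - u)"
    proof (cases "x = u")
      case False
      then show ?thesis
        using const[of x] x by (simp add: q_def field_simps)
    qed simp
  qed
qed

section \<open>Arithmetic of \<open>N\<close>-adic rationals\<close>

text \<open>A negative exponent can be absorbed into the numerator. With natural exponents two
  fractions have the common denominator \<open>N ^ (m + n)\<close>, which is what closure under
  addition needs.\<close>

lemma nadic_rationals_alt:
  assumes "N > 0"
  shows "nadic_rationals N = {of_int k / real N ^ n | k n. True}"
proof (intro equalityI subsetI)
  fix x assume "x \<in> nadic_rationals N"
  then obtain k m :: int where x: "x = of_int k / real N powi m"
    by (auto simp: nadic_rationals_def)
  show "x \<in> {of_int k / real N ^ n | k n. True}"
  proof (cases "m \<ge> 0")
    case True
    then show ?thesis using x by (auto simp: power_int_def)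
  next
    case False
    then have "x = of_int (k * int N ^ nat (- m)) / real N ^ 0"
      using x assms by (simp add: power_int_def field_simps)
    then show ?thesis by blast
  qed
next
  fix x assume "x \<in> {of_int k / real N ^ n | k n. True}"
  then obtain k :: int and n :: nat where "x = of_int k / real N ^ n"
    by auto
  then have "x = of_int k / real N powi (int n)"
    by simp
  then show "x \<in> nadic_rationals N"
    unfolding nadic_rationals_def by blast
qed

lemma nadic_rationals_add:
  assumes N: "N > 0" and x: "x \<in> nadic_rationals N" and y: "y \<in> nadic_rationals N"
  shows "x + y \<in> nadic_rationals N"
proof -
  obtain k l :: int and m n :: nat 
    where xy: "x = of_int k / real N ^ m" "y = of_int l / real N ^ n"
    using x y unfolding nadic_rationals_alt[OF N] by auto
  have "x + y = of_int (k * int N ^ n + l * int N ^ m) / real N ^ (m + n)"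
    unfolding xy using N by (simp add: field_simps power_add)
  then show ?thesis
    unfolding nadic_rationals_alt[OF N] by blast
qed

lemma nadic_rationals_mult_powi:
  assumes N: "N > 0" and x: "x \<in> nadic_rationals N"
  shows "real N powi k * x \<in> nadic_rationals N"
proof -
  obtain l m :: int where "x = of_int l / real N powi m"
    using x unfolding nadic_rationals_def by auto
  then have "real N powi k * x = of_int l / real N powi (m - k)"
    using N by (simp add: power_int_diff)
  then show ?thesis
    unfolding nadic_rationals_def by blast
qed

lemma nadic_rationals_uminus:
  assumes "x \<in> nadic_rationals N"
  shows "- x \<in> nadic_rationals N"
proof -
  obtain k m :: int where "x = of_int k / real N powi m"
    using assms unfolding nadic_rationals_def by auto
  then have "- x = of_int (- k) / real N powi m"
    by simp
  then show ?thesis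
    unfolding nadic_rationals_def by blast
qed

lemma nadic_rationals_diff:
  "N > 0 \<Longrightarrow> x \<in> nadic_rationals N \<Longrightarrow> y \<in> nadic_rationals N \<Longrightarrow> x - y \<in> nadic_rationals N"
  using nadic_rationals_add[of N x "- y"] nadic_rationals_uminus[of y N] by simp

lemma nadic_rationals_of_int: "of_int k \<in> nadic_rationals N"
  unfolding nadic_rationals_def by (rule CollectI, rule exI[of _ k], rule exI[of _ 0]) simp

lemma countable_nadic_rationals: "countable (nadic_rationals N)"
proof -
  have "nadic_rationals N = (\<lambda>(k, m). of_int k / real N powi m) ` (UNIV :: (int \<times> int) set)"
    by (auto simp: nadic_rationals_def)
  then show ?thesis
    by simp
qed

text \<open>The affine pieces are taken on closed intervals and have \<open>N\<close>-adic constant terms; this is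
  what makes composition and inversion preserve the notion.\<close>

definition nadic_pieces :: "nat \<Rightarrow> (real \<Rightarrow> real) \<Rightarrow> real set \<Rightarrow> bool" where
  "nadic_pieces N f S \<longleftrightarrow> finite S \<and> S \<subseteq> nadic_rationals N \<and>
     (\<forall>u v. 0 \<le> u \<and> u < v \<and> v \<le> 1 \<and> {u<..<v} \<inter> S = {} \<longrightarrow>
        (\<exists>k::int. \<exists>c\<in>nadic_rationals N. \<forall>x\<in>{u..v}. f x = real N powi k * x + c))"

lemma nadic_piecesD:
  assumes "nadic_pieces N f S" "0 \<le> u" "u < v" "v \<le> 1" "{u<..<v} \<inter> S = {}"
  obtains k :: int and c where "c \<in> nadic_rationals N"
    "\<And>x. x \<in> {u..v} \<Longrightarrow> f x = real N powi k * x + c"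
  using assms unfolding nadic_pieces_def by metis

section \<open>Elements of the group have \<open>N\<close>-adic affine pieces\<close>

text \<open>A continuous injection is strictly monotone, so it sends interior points strictly
  between the two endpoint values and only endpoints can be mapped to \<open>0\<close> or
  \<open>1\<close>. Either value of \<open>f 0\<close> is \<open>N\<close>-adic, which starts the
  induction along the breakpoints.\<close>

lemma homeomorphism_unit_interval_0:
  fixes f :: "real \<Rightarrow> real"
  assumes "homeomorphism {0..1} {0..1} f g"
  shows "f 0 \<in> {0, 1}"
proof -
  have im: "f ` {0..1} = {0..1}" and cont: "continuous_on {0..1} f"
    using assms by (auto simp: homeomorphism_def)
  have inj: "inj_on f {0..1}"
    using assms unfolding homeomorphism_def by (metis inj_on_inverseI)
  have endp: "x = 0 \<or> x = 1" if x: "x \<in> {0..1}" and fx: "f x = 0 \<or> f x = 1" for x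
  proof (rule ccontr)
    assume "\<not> ?thesis"
    then have "(f 0 < f x \<and> f x < f 1) \<or> (f 1 < f x \<and> f x < f 0)"
      using x by (intro continuous_inj_imp_mono cont inj) auto
    moreover have "f 0 \<in> {0..1}" "f 1 \<in> {0..1}"
      using im by auto
    ultimately show False
      using fx by auto
  qed
  have "\<exists>x\<in>{0..1}. f x = 0" "\<exists>x\<in>{0..1}. f x = 1"
    using im by (metis atLeastAtMost_iff imageE order_refl zero_le_one)+
  then obtain x y where "x \<in> {0..1}" "f x = 0" "y \<in> {0..1}" "f y = 1"
    by auto
  with endp[of x] endp[of y] show ?thesis
    by auto
qed

text \<open>The point is the largest element of \<open>S\<close> below \<open>v\<close>; it exists
  and is nonnegative because \<open>0\<close> is a candidate.\<close>

lemma gap_below: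
  fixes S :: "real set"
  assumes "finite S" "0 \<in> S" "0 < v"
  obtains s where "s \<in> S" "0 \<le> s" "s < v" "{s<..<v} \<inter> S = {}"
proof -
  let ?T = "{s\<in>S. s < v}"
  have T: "finite ?T" "0 \<in> ?T"
    using assms by auto
  show ?thesis
  proof
    show "Max ?T \<in> S" "Max ?T < v"
      using Max_in[of ?T] T by blast+
    show "0 \<le> Max ?T"
      using T by simp
    show "{Max ?T<..<v} \<inter> S = {}"
      using Max_ge[OF T(1)] by (force simp: not_less)
  qed
qed

text \<open>Being \<open>N\<close>-adic propagates from left to right: between consecutive
  breakpoints \<open>r < t\<close> one has \<open>f t = f r + N powi k * (t - r)\<close>, so
  \<open>f t\<close> is \<open>N\<close>-adic as soon as \<open>f r\<close> is.\<close>

lemma thompson_F_nadic_pieces: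
  assumes N: "N \<ge> 2" and f: "f \<in> thompson_F N"
  shows "\<exists>S. nadic_pieces N f S"
proof -
  \<comment> \<open>Adding \<open>0\<close> to the points of non-differentiability gives every
    positive point a breakpoint to its left.\<close>
  define S where "S = insert 0 {x \<in> {0..1}. \<not> f differentiable (at x within {0..1})}"
  obtain g where hom: "homeomorphism {0..1} {0..1} f g"
    using f by (auto simp: thompson_F_def)
  then have cont: "continuous_on {0..1} f"
    by (auto simp: homeomorphism_def)
  have S: "finite S" "0 \<in> S"
    using f by (auto simp: S_def thompson_F_def)
  have S_nadic: "S \<subseteq> nadic_rationals N"
    using f nadic_rationals_of_int[of 0 N] by (auto simp: S_def thompson_F_def)
  have S01: "S \<subseteq> {0..1}"
    by (auto simp: S_def)
  have piece: "\<exists>k::int. \<forall>x\<in>{u..v}. f x = f u + real N powi k * (x - u)"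
    if uv: "0 \<le> u" "u < v" "v \<le> 1" "{u<..<v} \<inter> S = {}" for u v
  proof -
    have "\<exists>d\<in>range (\<lambda>k::int. real N powi k). \<forall>x\<in>{u..v}. f x = f u + d * (x - u)"
    proof (rule affine_if_countable_derivative)
      show "continuous_on {u..v} f"
        by (rule continuous_on_subset[OF cont]) (use uv in auto)
      fix x assume x: "u < x" "x < v"
      then have "f differentiable (at x within {0..1})"
        using uv by (auto simp: S_def)
      then obtain k :: int where "(f has_real_derivative (real N powi k)) (at x within {0..1})"
        using f x uv unfolding thompson_F_def by fastforce
      moreover have "at x within {0..1} = at x"
        using x uv by (intro at_within_Icc_at) auto
      ultimately show "\<exists>d\<in>range (\<lambda>k::int. real N powi k). (f has_real_derivative d) (at x)"
        by auto
    qed (use uv in auto)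
    then show ?thesis by auto
  qed
  have f_nadic: "f s \<in> nadic_rationals N" if "s \<in> S" for s
  proof (rule ccontr)
    assume "f s \<notin> nadic_rationals N"
    \<comment> \<open>Minimal counterexample: the breakpoint \<open>r\<close> just before the least
      bad breakpoint \<open>t\<close> is good and forces \<open>t\<close> to be good.\<close>
    let ?B = "{s\<in>S. f s \<notin> nadic_rationals N}"
    define t where "t = Min ?B"
    have fin: "finite ?B" and ne: "?B \<noteq> {}"
      using S that \<open>f s \<notin> _\<close> by auto
    have t: "t \<in> S" "f t \<notin> nadic_rationals N"
      using Min_in[OF fin ne] by (auto simp: t_def)
    have "f 0 \<in> nadic_rationals N"
      using homeomorphism_unit_interval_0[OF hom]
        nadic_rationals_of_int[of 0 N] nadic_rationals_of_int[of 1 N] by auto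
    then have "t \<noteq> 0"
      using t by auto
    then have t01: "0 < t" "t \<le> 1"
      using t S01 by force+
    obtain r where r: "r \<in> S" "0 \<le> r" "r < t" "{r<..<t} \<inter> S = {}"
      using gap_below[OF S t01(1)] .
    have "r \<notin> ?B"
      using Min_le[OF fin, of r] r by (auto simp: t_def)
    then have fr: "f r \<in> nadic_rationals N"
      using r by auto
    obtain k :: int where k: "\<forall>x\<in>{r..t}. f x = f r + real N powi k * (x - r)"
      using piece[of r t] r t01 by auto
    have "f t = f r + real N powi k * (t - r)"
      using bspec[OF k, of t] r by simp
    also have "\<dots> \<in> nadic_rationals N"
      using N fr r(1) t(1) S_nadic
      by (intro nadic_rationals_add nadic_rationals_mult_powi nadic_rationals_diff) auto
    finally show False
      using t by simp
  qed
  have "\<exists>k::int. \<exists>c\<in>nadic_rationals N. \<forall>x\<in>{u..v}. f x = real N powi k * x + c"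
    if uv: "0 \<le> u" "u < v" "v \<le> 1" "{u<..<v} \<inter> S = {}" for u v
  proof -
    \<comment> \<open>The endpoint \<open>u\<close> need not be \<open>N\<close>-adic, so the
      constant term is computed from the last breakpoint \<open>r\<close> before \<open>v\<close>,
      whose affine piece contains \<open>{u..v}\<close>.\<close>
    obtain r where r: "r \<in> S" "0 \<le> r" "r < v" "{r<..<v} \<inter> S = {}"
      using gap_below[OF S, of v] uv by auto
    have "r \<le> u"
      using r uv by force
    obtain k :: int where k: "\<forall>x\<in>{r..v}. f x = f r + real N powi k * (x - r)"
      using piece[of r v] r uv by auto
    have "f r - real N powi k * r \<in> nadic_rationals N"
      using N f_nadic[OF r(1)] r(1) S_nadic
      by (intro nadic_rationals_mult_powi nadic_rationals_diff) auto
    moreover have "f x = real N powi k * x + (f r - real N powi k * r)" if "x \<in> {u..v}" for x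
      using bspec[OF k, of x] \<open>r \<le> u\<close> that by (simp add: algebra_simps)
    ultimately show ?thesis by blast
  qed
  then have "nadic_pieces N f S"
    unfolding nadic_pieces_def using S S_nadic by blast
  then show ?thesis ..
qed

section \<open>Recognising elements of the group by their affine pieces\<close>

lemma small_gap:
  fixes S :: "real set"
  assumes "finite S"
  obtains e where "e > 0" "\<And>y. y \<in> S \<Longrightarrow> y \<noteq> x \<Longrightarrow> e \<le> \<bar>y - x\<bar>"
  using finite_set_avoid[OF assms, of x] by (metis dist_commute dist_real_def)

lemma adjacent_gap:
  fixes S :: "real set"
  assumes "finite S" "x \<in> {0..1}"
  obtains u v where "0 \<le> u" "u < v" "v \<le> 1" "{u<..<v} \<inter> S = {}" "x \<in> {u..v}"
proof -
  obtain e where e: "e > 0" "\<And>y. y \<in> S \<Longrightarrow> y \<noteq> x \<Longrightarrow> e \<le> \<bar>y - x\<bar>"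
    using small_gap[OF assms(1)] by metis
  show ?thesis
  proof (cases "x < 1")
    case True
    have "{x<..<min 1 (x + e)} \<inter> S = {}"
      using e(2) by force
    then show ?thesis
      using that[of x "min 1 (x + e)"] True e(1) assms(2) by auto
  next
    case False
    have "{max 0 (x - e)<..<x} \<inter> S = {}"
      using e(2) by force
    then show ?thesis
      using that[of "max 0 (x - e)" x] False e(1) assms(2) by auto
  qed
qed

lemma nadic_pieces_at:
  assumes "nadic_pieces N f S" "x \<in> {0..1}"
  obtains k :: int and c where "c \<in> nadic_rationals N" "f x = real N powi k * x + c"
proof -
  have "finite S"
    using assms by (simp add: nadic_pieces_def)
  then obtain u v where "0 \<le> u" "u < v" "v \<le> 1" "{u<..<v} \<inter> S = {}" "x \<in> {u..v}"
    using adjacent_gap assms(2) by metis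
  then show ?thesis
    using nadic_piecesD[OF assms(1)] that by metis
qed

text \<open>Off \<open>S\<close> the function agrees near \<open>x\<close> with one affine map and
  is differentiable there, so all points of non-differentiability lie in \<open>S\<close>. This
  reduces membership to exhibiting a homeomorphism together with its breakpoints.\<close>

lemma thompson_FI:
  assumes ext: "f \<in> extensional {0..1}" and hom: "\<exists>g. homeomorphism {0..1} {0..1} f g"
    and S: "nadic_pieces N f S"
  shows "f \<in> thompson_F N"
proof -
  have fin: "finite S"
    using S by (simp add: nadic_pieces_def)
  have diff: "f differentiable (at x within {0..1})" if x: "x \<in> {0..1}" "x \<notin> S" for x
  proof -
    obtain e where e: "e > 0" "\<And>y. y \<in> S \<Longrightarrow> y \<noteq> x \<Longrightarrow> e \<le> \<bar>y - x\<bar>"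
      using small_gap[OF fin] by metis
    define u v where "u = max 0 (x - e)" and "v = min 1 (x + e)"
    have uv: "0 \<le> u" "u < v" "v \<le> 1" "{u<..<v} \<inter> S = {}"
      using x e by (force simp: u_def v_def)+
    obtain k :: int and c where c: "\<And>x. x \<in> {u..v} \<Longrightarrow> f x = real N powi k * x + c"
      using nadic_piecesD[OF S uv] by metis
    have "((\<lambda>x. real N powi k * x + c) has_real_derivative (real N powi k)) (at x within {0..1})"
      by (auto intro!: derivative_eq_intros)
    then have "(f has_real_derivative (real N powi k)) (at x within {0..1})"
    proof (rule has_field_derivative_transform_within)
      show "real N powi k * y + c = f y" if "y \<in> {0..1}" "dist y x < e" for y
        using c[of y] that by (simp add: u_def v_def dist_real_def abs_less_iff)
    qed (use e x in auto)
    then show ?thesis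
      by (auto simp: real_differentiable_def)
  qed
  have der: "\<exists>k::int. (f has_real_derivative (real N powi k)) (at x within {0..1})"
    if x: "x \<in> {0..1}" and d: "f differentiable (at x within {0..1})" for x
  proof -
    \<comment> \<open>A point of \<open>S\<close> may still be a point of differentiability. The
      derivative is then found on one adjacent piece: \<open>x\<close> is a limit point of
      \<open>{u..v}\<close>, so the derivative within that interval is unique and equals the
      slope.\<close>
    obtain u v where uv: "0 \<le> u" "u < v" "v \<le> 1" "{u<..<v} \<inter> S = {}" "x \<in> {u..v}"
      using adjacent_gap[OF fin x] .
    obtain k :: int and c where c: "\<And>x. x \<in> {u..v} \<Longrightarrow> f x = real N powi k * x + c"
      using nadic_piecesD[OF S uv(1-4)] by metis
    obtain d where d: "(f has_real_derivative d) (at x within {0..1})"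
      using d by (auto simp: real_differentiable_def)
    then have "(f has_real_derivative d) (at x within {u..v})"
      by (rule has_field_derivative_subset) (use uv in auto)
    moreover have "((\<lambda>x. real N powi k * x + c) has_real_derivative (real N powi k))
        (at x within {u..v})"
      by (auto intro!: derivative_eq_intros)
    then have "(f has_real_derivative (real N powi k)) (at x within {u..v})"
      by (rule has_field_derivative_transform_within[where d = 1]) (use uv c in auto)
    moreover have "at x within {u..v} \<noteq> bot"
      using uv by (simp add: trivial_limit_within islimpt_Icc)
    ultimately have "d = real N powi k"
      unfolding has_field_derivative_iff by (auto intro: tendsto_unique)
    then show ?thesis
      using d by auto
  qed
  have "piecewise_linear_on 0 1 f"
    unfolding piecewise_linear_on_def
  proof (intro exI[of _ S] conjI allI impI)
    fix u v assume "0 \<le> u \<and> u < v \<and> v \<le> 1 \<and> {u<..<v} \<inter> S = {}"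
    then obtain k :: int and c where "\<And>x. x \<in> {u..v} \<Longrightarrow> f x = real N powi k * x + c"
      using nadic_piecesD[OF S] by metis
    then have "\<forall>x\<in>{u<..<v}. f x = real N powi k * x + c"
      by auto
    then show "\<exists>m c. \<forall>x\<in>{u<..<v}. f x = m * x + c" by blast
  qed (use fin in auto)
  moreover have "{x \<in> {0..1}. \<not> f differentiable (at x within {0..1})} \<subseteq> S"
    using diff by auto
  moreover have "S \<subseteq> nadic_rationals N"
    using S by (simp add: nadic_pieces_def)
  ultimately show ?thesis
    using ext hom der fin unfolding thompson_F_def by (auto intro: finite_subset)
qed

section \<open>The orbit relation is an equivalence relation\<close>

lemma thompson_F_bij:
  assumes "f \<in> thompson_F N"
  shows "continuous_on {0..1} f" "inj_on f {0..1}" "f ` {0..1} = {0..1}"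
proof -
  obtain g where "homeomorphism {0..1} {0..1} f g"
    using assms by (auto simp: thompson_F_def)
  then show "continuous_on {0..1} f" "inj_on f {0..1}" "f ` {0..1} = {0..1}"
    unfolding homeomorphism_def by (auto intro: inj_on_inverseI)
qed

lemma homeomorphism_restrict:
  assumes "homeomorphism S T f g"
  shows "homeomorphism S T (restrict f S) (restrict g T)"
  by (rule homeomorphism_cong[OF assms]) auto

lemma thompson_F_id: "restrict (\<lambda>x. x) {0..1} \<in> thompson_F N"
proof (rule thompson_FI)
  have "homeomorphism {0..1::real} {0..1} (\<lambda>x. x) (\<lambda>x. x)"
    by (simp add: homeomorphism_def)
  then show "\<exists>g. homeomorphism {0..1::real} {0..1} (restrict (\<lambda>x. x) {0..1}) g"
    by (blast intro: homeomorphism_restrict)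
  show "nadic_pieces N (restrict (\<lambda>x. x) {0..1}) {}"
    unfolding nadic_pieces_def
  proof (intro conjI allI impI)
    fix u v :: real assume "0 \<le> u \<and> u < v \<and> v \<le> 1 \<and> {u<..<v} \<inter> {} = {}"
    then show "\<exists>k::int. \<exists>c\<in>nadic_rationals N. \<forall>x\<in>{u..v}.
        restrict (\<lambda>x. x) {0..1} x = real N powi k * x + c"
      using nadic_rationals_of_int[of 0 N]
      by (intro exI[of _ 0] bexI[of _ 0]) auto
  qed auto
qed auto

text \<open>As the slope is a power of \<open>N\<close>, the inverse affine map again has a power of
  \<open>N\<close> as slope and an \<open>N\<close>-adic constant term.\<close>

lemma affine_vimage_nadic:
  assumes N: "N > 0" and "y \<in> nadic_rationals N" "c \<in> nadic_rationals N"
    and y: "y = real N powi k * x + c"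
  shows "x \<in> nadic_rationals N"
proof -
  have "x = real N powi (- k) * (y - c)"
    using N y by (simp add: power_int_minus field_simps)
  then show ?thesis
    using nadic_rationals_mult_powi[OF N nadic_rationals_diff[OF N assms(2,3)], of "- k"] by simp
qed

lemma thompson_F_comp:
  assumes N: "N \<ge> 2" and f: "f \<in> thompson_F N" and h: "h \<in> thompson_F N"
  shows "restrict (h \<circ> f) {0..1} \<in> thompson_F N"
proof -
  obtain S where S: "nadic_pieces N f S"
    using thompson_F_nadic_pieces[OF N f] ..
  obtain T where T: "nadic_pieces N h T"
    using thompson_F_nadic_pieces[OF N h] ..
  \<comment> \<open>The composition can break where \<open>f\<close> does or where \<open>f\<close>
    hits a breakpoint of \<open>h\<close>. The latter points are \<open>N\<close>-adic because they
    are preimages of \<open>N\<close>-adic numbers under \<open>N\<close>-adic affine maps.\<close>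
  define U where "U = S \<union> (f -` T \<inter> {0..1})"
  show ?thesis
  proof (rule thompson_FI)
    obtain f' h' where "homeomorphism {0..1} {0..1} f f'" "homeomorphism {0..1} {0..1} h h'"
      using f h by (auto simp: thompson_F_def)
    then show "\<exists>g. homeomorphism {0..1} {0..1} (restrict (h \<circ> f) {0..1}) g"
      by (blast intro: homeomorphism_restrict homeomorphism_compose)
    have "finite (f -` T \<inter> {0..1})"
      using T thompson_F_bij(2)[OF f] by (intro finite_vimage_IntI) (auto simp: nadic_pieces_def)
    then have "finite U"
      using S by (simp add: U_def nadic_pieces_def)
    moreover have "x \<in> nadic_rationals N" if x: "x \<in> f -` T" "x \<in> {0..1}" for x
    proof -
      obtain k :: int and c where c: "c \<in> nadic_rationals N" "f x = real N powi k * x + c"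
        using nadic_pieces_at[OF S x(2)] .
      moreover have "f x \<in> nadic_rationals N"
        using T x by (auto simp: nadic_pieces_def)
      ultimately show ?thesis
        using affine_vimage_nadic[of N "f x" c k x] N by simp
    qed
    then have "U \<subseteq> nadic_rationals N"
      using S by (auto simp: U_def nadic_pieces_def)
    moreover have "\<exists>k::int. \<exists>c\<in>nadic_rationals N. \<forall>x\<in>{u..v}.
        restrict (h \<circ> f) {0..1} x = real N powi k * x + c"
      if uv: "0 \<le> u" "u < v" "v \<le> 1" "{u<..<v} \<inter> U = {}" for u v
    proof -
      obtain k :: int and c where c: "c \<in> nadic_rationals N"
        "\<And>x. x \<in> {u..v} \<Longrightarrow> f x = real N powi k * x + c"
        using nadic_piecesD[OF S uv(1-3)] uv(4) unfolding U_def by (metis Int_Un_distrib Un_empty)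
      have pos: "real N powi k > 0"
        using N by simp
      have f01: "f u \<in> {0..1}" "f v \<in> {0..1}"
        using thompson_F_bij(3)[OF f] uv by auto
      have "f u < f v"
        using c(2)[of u] c(2)[of v] uv pos by simp
      \<comment> \<open>On \<open>{u..v}\<close> the map \<open>f\<close> is affine and increasing,
        so a breakpoint of \<open>h\<close> between \<open>f u\<close> and \<open>f v\<close> would
        pull back to a point of \<open>U\<close> between \<open>u\<close> and
        \<open>v\<close>.\<close>
      moreover have "{f u<..<f v} \<inter> T = {}"
      proof (rule ccontr)
        assume "\<not> ?thesis"
        then obtain y where y: "y \<in> T" "f u < y" "y < f v"
          by auto
        define x where "x = (y - c) / real N powi k"
        have "u < x" "x < v"
          using y c(2)[of u] c(2)[of v] uv pos by (simp_all add: x_def field_simps)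
        moreover from this have "f x = y"
          using c(2)[of x] N by (simp add: x_def)
        ultimately show False
          using y uv by (auto simp: U_def)
      qed
      ultimately obtain l :: int and d where d: "d \<in> nadic_rationals N"
        "\<And>x. x \<in> {f u..f v} \<Longrightarrow> h x = real N powi l * x + d"
        using nadic_piecesD[OF T, of "f u" "f v"] f01 by (metis atLeastAtMost_iff)
      have "restrict (h \<circ> f) {0..1} x = real N powi (l + k) * x + (real N powi l * c + d)"
        if x: "x \<in> {u..v}" for x
      proof -
        have "f x \<in> {f u..f v}"
          using x uv c(2) pos by auto
        then have "h (f x) = real N powi l * (real N powi k * x + c) + d"
          using d(2) c(2)[OF x] by simp
        then show ?thesis
          using x uv N by (simp add: power_int_add algebra_simps)
      qed
      moreover have "real N powi l * c + d \<in> nadic_rationals N"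
        using N c d by (intro nadic_rationals_add nadic_rationals_mult_powi) auto
      ultimately show ?thesis by blast
    qed
    ultimately show "nadic_pieces N (restrict (h \<circ> f) {0..1}) U"
      unfolding nadic_pieces_def by blast
  qed auto
qed

text \<open>The breakpoints of the inverse are the images of those of \<open>f\<close>, and a piece
  \<open>N powi k * x + c\<close> is inverted to
  \<open>N powi (- k) * y - N powi (- k) * c\<close>.\<close>

lemma thompson_F_inverse:
  assumes N: "N \<ge> 2" and f: "f \<in> thompson_F N"
  obtains g where "g \<in> thompson_F N" "\<And>x. x \<in> {0..1} \<Longrightarrow> g (f x) = x"
proof -
  obtain S where S: "nadic_pieces N f S"
    using thompson_F_nadic_pieces[OF N f] ..
  obtain g0 where g0: "homeomorphism {0..1} {0..1} f g0"
    using f by (auto simp: thompson_F_def)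
  define g where "g = restrict g0 {0..1}"
  have gf: "g (f x) = x" if "x \<in> {0..1}" for x
    using g0 that by (force simp: g_def homeomorphism_def)
  have fg: "f (g y) = y" "g y \<in> {0..1}" if "y \<in> {0..1}" for y
    using g0 that by (auto simp: g_def homeomorphism_def)
  define T where "T = f ` (S \<inter> {0..1})"
  have "g \<in> thompson_F N"
  proof (rule thompson_FI)
    have "homeomorphism {0..1} {0..1} g (restrict f {0..1})"
      unfolding g_def by (intro homeomorphism_restrict) (use g0 homeomorphism_symD in blast)
    then show "\<exists>h. homeomorphism {0..1} {0..1} g h" by blast
    have "finite T"
      using S by (simp add: T_def nadic_pieces_def)
    moreover have "f x \<in> nadic_rationals N" if x: "x \<in> S" "x \<in> {0..1}" for x
    proof -
      obtain k :: int and c where c: "c \<in> nadic_rationals N" "f x = real N powi k * x + c"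
        using nadic_pieces_at[OF S x(2)] .
      moreover have "x \<in> nadic_rationals N"
        using S x by (auto simp: nadic_pieces_def)
      ultimately show ?thesis
        using N by (simp add: nadic_rationals_add nadic_rationals_mult_powi)
    qed
    then have "T \<subseteq> nadic_rationals N"
      by (auto simp: T_def)
    moreover have "\<exists>k::int. \<exists>c\<in>nadic_rationals N. \<forall>y\<in>{u..v}. g y = real N powi k * y + c"
      if uv: "0 \<le> u" "u < v" "v \<le> 1" "{u<..<v} \<inter> T = {}" for u v
    proof -
      \<comment> \<open>At this point the orientation of \<open>g\<close> is unknown, hence
        \<open>min\<close> and \<open>max\<close>. The positive slope of \<open>f\<close> on
        \<open>{a..b}\<close> later rules out the reversed case.\<close>
      define a b where "a = min (g u) (g v)" and "b = max (g u) (g v)"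
      have fgu: "f (g u) = u" "f (g v) = v" "g u \<in> {0..1}" "g v \<in> {0..1}"
        using fg uv by auto
      moreover have "g u \<noteq> g v"
        using fgu uv by auto
      ultimately have ab: "0 \<le> a" "a < b" "b \<le> 1"
        by (auto simp: a_def b_def)
      have fab: "(f a = u \<and> f b = v) \<or> (f a = v \<and> f b = u)"
        using fgu by (auto simp: a_def b_def min_def max_def)
      have "{a<..<b} \<inter> S = {}"
      proof (rule ccontr)
        assume "\<not> ?thesis"
        then obtain x where x: "x \<in> S" "a < x" "x < b"
          by auto
        have "continuous_on {a..b} f"
          by (rule continuous_on_subset[OF thompson_F_bij(1)[OF f]]) (use ab in auto)
        moreover have "inj_on f {a..b}"
          by (rule inj_on_subset[OF thompson_F_bij(2)[OF f]]) (use ab in auto)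
        ultimately have "(f a < f x \<and> f x < f b) \<or> (f b < f x \<and> f x < f a)"
          using x by (intro continuous_inj_imp_mono) auto
        then have "f x \<in> {u<..<v}"
          using fab uv by auto
        moreover have "f x \<in> T"
          using x ab by (auto simp: T_def)
        ultimately show False
          using uv by auto
      qed
      then obtain k :: int and c where c: "c \<in> nadic_rationals N"
        "\<And>x. x \<in> {a..b} \<Longrightarrow> f x = real N powi k * x + c"
        using nadic_piecesD[OF S ab] by metis
      have pos: "real N powi k > 0"
        using N by simp
      have "f a < f b"
        using c(2)[of a] c(2)[of b] ab pos by simp
      then have fu: "f a = u" "f b = v"
        using fab uv by auto
      have "g y = real N powi (- k) * y + - (real N powi (- k) * c)" if y: "y \<in> {u..v}" for y
      proof -
        define x where "x = (y - c) / real N powi k"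
        have "a \<le> x" "x \<le> b"
          using y c(2)[of a] c(2)[of b] fu ab pos by (simp_all add: x_def field_simps)
        moreover from this have "f x = y"
          using c(2)[of x] N by (simp add: x_def)
        ultimately have "g y = x"
          using gf[of x] ab by auto
        then show ?thesis
          using N by (simp add: x_def power_int_minus field_simps)
      qed
      moreover have "- (real N powi (- k) * c) \<in> nadic_rationals N"
        using N c(1) by (intro nadic_rationals_uminus nadic_rationals_mult_powi) auto
      ultimately show ?thesis by blast
    qed
    ultimately show "nadic_pieces N g T"
      unfolding nadic_pieces_def by blast
  qed (auto simp: g_def)
  with gf that show ?thesis by blast
qed

lemma equiv_thompson_orbit_rel:
  assumes N: "N \<ge> 2"
  shows "equiv {0..1} (thompson_orbit_rel N)"
proof (rule equivI)
  show "thompson_orbit_rel N \<subseteq> {0..1} \<times> {0..1}"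
    by (auto simp: thompson_orbit_rel_def)
  show "refl_on {0..1} (thompson_orbit_rel N)"
  proof (rule refl_onI)
    fix x :: real assume "x \<in> {0..1}"
    then show "(x, x) \<in> thompson_orbit_rel N"
      unfolding thompson_orbit_rel_def using bexI[OF _ thompson_F_id[of N]] by auto
  qed
  show "sym (thompson_orbit_rel N)"
  proof (rule symI)
    fix x y assume xy: "(x, y) \<in> thompson_orbit_rel N"
    then obtain f where f: "f \<in> thompson_F N" "f x = y" "x \<in> {0..1}"
      by (auto simp: thompson_orbit_rel_def)
    obtain g where "g \<in> thompson_F N" "g (f x) = x"
      using thompson_F_inverse[OF N f(1)] f(3) by metis
    then show "(y, x) \<in> thompson_orbit_rel N"
      using f xy by (auto simp: thompson_orbit_rel_def)
  qed
  show "trans (thompson_orbit_rel N)"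
  proof (rule transI)
    fix x y z assume xyz: "(x, y) \<in> thompson_orbit_rel N" "(y, z) \<in> thompson_orbit_rel N"
    then obtain f h where "f \<in> thompson_F N" "f x = y" "h \<in> thompson_F N" "h y = z"
      by (auto simp: thompson_orbit_rel_def)
    then have "\<exists>f\<in>thompson_F N. f x = z"
      using thompson_F_comp[OF N] xyz
      by (intro bexI[of _ "restrict (h \<circ> f) {0..1}"]) (auto simp: thompson_orbit_rel_def)
    then show "(x, z) \<in> thompson_orbit_rel N"
      using xyz by (auto simp: thompson_orbit_rel_def)
  qed
qed

section \<open>Standardness and quasi-preservation\<close>

text \<open>The relation is covered by the graphs of a countable family of affine maps. Countability
  of orbits and quasi-preservation both rest on this.\<close>

lemma thompson_orbit_rel_affine:
  assumes N: "N \<ge> 2" and xy: "(x, y) \<in> thompson_orbit_rel N"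
  obtains k :: int and c where "c \<in> nadic_rationals N" "y = real N powi k * x + c"
proof -
  obtain f where f: "f \<in> thompson_F N" "f x = y" "x \<in> {0..1}"
    using xy by (auto simp: thompson_orbit_rel_def)
  obtain S where "nadic_pieces N f S"
    using thompson_F_nadic_pieces[OF N f(1)] ..
  from nadic_pieces_at[OF this f(3)] f(2) that show ?thesis
    by metis
qed

lemma countable_thompson_orbit:
  assumes N: "N \<ge> 2"
  shows "countable (thompson_orbit_rel N `` {x})"
proof (rule countable_subset)
  show "thompson_orbit_rel N `` {x} \<subseteq>
      (\<lambda>(k, c). real N powi k * x + c) ` ((UNIV :: int set) \<times> nadic_rationals N)"
  proof
    fix y assume "y \<in> thompson_orbit_rel N `` {x}"
    then have "(x, y) \<in> thompson_orbit_rel N"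
      by auto
    then obtain k :: int and c where "c \<in> nadic_rationals N" "y = real N powi k * x + c"
      by (rule thompson_orbit_rel_affine[OF N])
    then show "y \<in> (\<lambda>(k, c). real N powi k * x + c) ` ((UNIV :: int set) \<times> nadic_rationals N)"
      by force
  qed
qed (simp add: countable_nadic_rationals)

text \<open>Away from the countably many \<open>N\<close>-adic \<open>x\<close>, every pair lies in the interior of an
  affine piece, so for fixed slope and constant term the relevant \<open>x\<close> form an open set.\<close>

lemma borel_thompson_orbit_rel:
  assumes N: "N \<ge> 2"
  shows "thompson_orbit_rel N \<in> sets borel"
proof -
  \<comment> \<open>The union is taken over all suitable group elements at once: a union of open
    intervals is open whatever the size of the family.\<close>
  define U where "U k c = \<Union>{{u<..<v} | u v. 0 \<le> u \<and> u < v \<and> v \<le> 1 \<and>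
      (\<exists>f\<in>thompson_F N. \<forall>x\<in>{u<..<v}. f x = real N powi k * x + c)}" for k :: int and c
  define G where "G k c = {p. fst p \<in> U k c \<and> snd p = real N powi k * fst p + c}"
    for k :: int and c
  \<comment> \<open>Pairs with \<open>N\<close>-adic first coordinate are split off. They form a
    countable set, since there are countably many such coordinates and each has a countable
    orbit.\<close>
  define Q where "Q = (SIGMA x:nadic_rationals N. thompson_orbit_rel N `` {x})"
  have "thompson_orbit_rel N = (\<Union>k. \<Union>c\<in>nadic_rationals N. G k c) \<union> Q"
  proof (intro equalityI subsetI)
    fix p assume p: "p \<in> thompson_orbit_rel N"
    obtain x y where xy: "p = (x, y)"
      by (cases p)
    obtain f where f: "f \<in> thompson_F N" "f x = y" "x \<in> {0..1}"
      using p xy by (auto simp: thompson_orbit_rel_def)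
    show "p \<in> (\<Union>k. \<Union>c\<in>nadic_rationals N. G k c) \<union> Q"
    proof (cases "x \<in> nadic_rationals N")
      case True
      then show ?thesis
        using p xy by (auto simp: Q_def)
    next
      case False
      obtain S where S: "nadic_pieces N f S"
        using thompson_F_nadic_pieces[OF N f(1)] ..
      then have fin: "finite S" and "S \<subseteq> nadic_rationals N"
        by (auto simp: nadic_pieces_def)
      then have "x \<notin> S" "x \<noteq> 0" "x \<noteq> 1"
        using False nadic_rationals_of_int[of 0 N] nadic_rationals_of_int[of 1 N] by auto
      then have x: "x \<notin> S" "0 < x" "x < 1"
        using f(3) by auto
      obtain e where e: "e > 0" "\<And>y. y \<in> S \<Longrightarrow> y \<noteq> x \<Longrightarrow> e \<le> \<bar>y - x\<bar>"
        using small_gap[OF fin] by metis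
      define u v where "u = max 0 (x - e)" and "v = min 1 (x + e)"
      have uv: "0 \<le> u" "u < v" "v \<le> 1" "{u<..<v} \<inter> S = {}" and xuv: "x \<in> {u<..<v}"
        using x e by (force simp: u_def v_def)+
      obtain k :: int and c where c: "c \<in> nadic_rationals N"
          "\<And>x. x \<in> {u..v} \<Longrightarrow> f x = real N powi k * x + c"
        using nadic_piecesD[OF S uv] by metis
      have "\<forall>x\<in>{u<..<v}. f x = real N powi k * x + c"
        using c(2) by auto
      then have "x \<in> U k c"
        unfolding U_def using uv xuv f(1) by blast
      then have "p \<in> G k c"
        using f(2) c(2)[of x] xuv by (auto simp: G_def xy)
      then show ?thesis
        using c(1) by blast
    qed
  next
    fix p assume "p \<in> (\<Union>k. \<Union>c\<in>nadic_rationals N. G k c) \<union> Q"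
    then show "p \<in> thompson_orbit_rel N"
    proof
      assume "p \<in> (\<Union>k. \<Union>c\<in>nadic_rationals N. G k c)"
      then obtain k c where "p \<in> G k c"
        by auto
      then obtain u v f where uv: "0 \<le> u" "u < v" "v \<le> 1" "fst p \<in> {u<..<v}"
        and f: "f \<in> thompson_F N" "\<forall>x\<in>{u<..<v}. f x = real N powi k * x + c"
        and p: "snd p = real N powi k * fst p + c"
        unfolding G_def U_def by blast
      have "f (fst p) = snd p"
        using uv f p by auto
      moreover have "fst p \<in> {0..1}"
        using uv by auto
      moreover from this have "f (fst p) \<in> {0..1}"
        using thompson_F_bij(3)[OF f(1)] by blast
      ultimately show ?thesis
        using f(1) by (cases p) (auto simp: thompson_orbit_rel_def)
    qed (auto simp: Q_def)
  qed
  moreover have "countable Q"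
    unfolding Q_def by (intro countable_SIGMA countable_nadic_rationals countable_thompson_orbit N)
  then have "Q \<in> sets borel"
    by (rule sets.countable[rotated]) auto
  moreover have "G k c \<in> sets borel" for k c
  proof -
    have "open (U k c)"
      unfolding U_def by (rule open_Union) auto
    then have "open {p::real \<times> real. fst p \<in> U k c}"
      using open_vimage_fst[of "U k c"] by (simp add: vimage_def)
    moreover have "closed {p::real \<times> real. snd p = real N powi k * fst p + c}"
      by (intro closed_Collect_eq continuous_intros)
    moreover have "G k c = {p. fst p \<in> U k c} \<inter> {p. snd p = real N powi k * fst p + c}"
      by (auto simp: G_def)
    ultimately show ?thesis
      by (simp add: sets.Int)
  qed
  moreover from this have "(\<Union>k. \<Union>c\<in>nadic_rationals N. G k c) \<in> sets borel"
    by (intro sets.countable_UN'' countable_nadic_rationals) auto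
  ultimately show ?thesis
    by (simp add: sets.Un)
qed

lemma standard_thompson_orbit_rel:
  assumes N: "N \<ge> 2"
  shows "standard_rel unit_lebesgue (thompson_orbit_rel N)"
proof -
  let ?M = "unit_lebesgue \<Otimes>\<^sub>M unit_lebesgue"
  have id: "(\<lambda>x. x) \<in> measurable unit_lebesgue borel"
    unfolding unit_lebesgue_def by (intro measurable_restrict_space1) simp
  \<comment> \<open>The relation is its own preimage under the identity map from the product of the
    restricted spaces to the Borel plane, so Borel measurability carries over.\<close>
  have "(\<lambda>p. (fst p, snd p)) \<in> measurable ?M (borel \<Otimes>\<^sub>M borel)"
    by (intro measurable_Pair measurable_compose[OF measurable_fst id]
        measurable_compose[OF measurable_snd id])
  then have "(\<lambda>p. (fst p, snd p)) -` thompson_orbit_rel N \<inter> space ?M \<in> sets ?M"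
    by (rule measurable_sets) (unfold borel_prod, rule borel_thompson_orbit_rel[OF N])
  moreover have "(\<lambda>p. (fst p, snd p)) -` thompson_orbit_rel N \<inter> space ?M = thompson_orbit_rel N"
    by (auto simp: space_pair_measure unit_lebesgue_def thompson_orbit_rel_def)
  ultimately have "thompson_orbit_rel N \<in> sets ?M"
    by simp
  then show ?thesis
    using countable_thompson_orbit[OF N] by (simp add: standard_rel_def)
qed

section \<open>Quasi-preservation\<close>

text \<open>This passes to \<open>negligible\<close> sets, which are stable under differentiable
  maps and countable unions.\<close>

lemma null_sets_completion_unit_lebesgue:
  "A \<in> null_sets (completion unit_lebesgue) \<longleftrightarrow> A \<subseteq> {0..1} \<and> negligible A"
proof
  assume "A \<in> null_sets (completion unit_lebesgue)"
  then obtain B where B: "B \<in> null_sets unit_lebesgue" "A \<subseteq> B"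
    by (auto simp: null_sets_completion_iff2)
  then have "B \<subseteq> {0..1}" "B \<in> null_sets lborel"
    by (simp_all add: unit_lebesgue_def null_sets_restrict_space)
  moreover from this have "negligible B"
    by (simp add: negligible_iff_null_sets null_sets_completionI)
  ultimately show "A \<subseteq> {0..1} \<and> negligible A"
    using B negligible_subset by blast
next
  assume A: "A \<subseteq> {0..1} \<and> negligible A"
  then obtain B where B: "B \<in> null_sets lborel" "A \<subseteq> B"
    by (auto simp: negligible_iff_null_sets null_sets_completion_iff2)
  have "B \<inter> {0..1} \<in> null_sets lborel"
    using B(1) by (rule null_set_Int2) simp
  then have "B \<inter> {0..1} \<in> null_sets unit_lebesgue"
    by (simp add: unit_lebesgue_def null_sets_restrict_space)
  moreover have "A \<subseteq> B \<inter> {0..1}"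
    using A B by blast
  ultimately show "A \<in> null_sets (completion unit_lebesgue)"
    unfolding null_sets_completion_iff2 by (rule bexI[rotated])
qed

text \<open>The saturation of \<open>A\<close> is covered by countably many affine images of
  \<open>A\<close>, each of them negligible.\<close>

lemma quasi_preserving_thompson_orbit_rel:
  assumes N: "N \<ge> 2"
  shows "quasi_preserving_rel unit_lebesgue (thompson_orbit_rel N)"
  unfolding quasi_preserving_rel_def null_sets_completion_unit_lebesgue
proof (intro ballI conjI)
  fix A :: "real set" assume "A \<in> null_sets (completion unit_lebesgue)"
  then have A: "negligible A"
    by (simp add: null_sets_completion_unit_lebesgue)
  show "thompson_orbit_rel N `` A \<subseteq> {0..1}"
    by (auto simp: thompson_orbit_rel_def)
  let ?I = "(UNIV :: int set) \<times> nadic_rationals N"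
  let ?B = "\<lambda>(k, c). (\<lambda>x. real N powi k * x + c) ` A"
  have "negligible (?B i)" for i
    using A by (cases i) (auto intro!: negligible_differentiable_image_negligible derivative_intros)
  then have "negligible (\<Union>(?B ` ?I))"
    by (intro negligible_countable_Union countable_image countable_SIGMA)
      (auto simp: countable_nadic_rationals)
  moreover have "thompson_orbit_rel N `` A \<subseteq> \<Union>(?B ` ?I)"
  proof
    fix y assume "y \<in> thompson_orbit_rel N `` A"
    then obtain x where x: "x \<in> A" "(x, y) \<in> thompson_orbit_rel N"
      by auto
    obtain k :: int and c where "c \<in> nadic_rationals N" "y = real N powi k * x + c"
      using thompson_orbit_rel_affine[OF N x(2)] .
    then show "y \<in> \<Union>(?B ` ?I)"
      using x(1) by force
  qed
  ultimately show "negligible (thompson_orbit_rel N `` A)"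
    by (rule negligible_subset)
qed

section \<open>Ergodicity\<close>

lemma thompson_orbit_rel_translation:
  fixes x :: real
  assumes N: "N \<ge> 2" and m: "m \<ge> 2" and p: "p = 1 / real N ^ m"
    and x: "p \<le> x" "x \<le> 1 - real N * p"
  shows "(x, x + (real N - 1) * p) \<in> thompson_orbit_rel N"
proof -
  define n where "n = real N"
  \<comment> \<open>The three lines are strictly increasing, and so is their minimum. The first two
    cross at \<open>p\<close>, the last two at \<open>1 - n * p\<close>; these are the breakpoints,
    and the slopes are \<open>n\<close>, \<open>1\<close> and \<open>1 / n\<close>.\<close>
  define \<phi> where "\<phi> x = min (n * x) (min (x + (n - 1) * p) (1 - (1 - x) / n))" for x
  have n: "n \<ge> 2"
    using N by (simp add: n_def)
  have p0: "p > 0"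
    using N p by simp
  \<comment> \<open>Here \<open>m \<ge> 2\<close> enters: it yields \<open>(n + 1) * p < 1\<close>,
    that is \<open>p < 1 - n * p\<close>, so that the breakpoints come in the right order.\<close>
  have "n ^ 2 \<le> n ^ m"
    using n m by (intro power_increasing) auto
  moreover have "2 * n \<le> n ^ 2"
    unfolding power2_eq_square using n by (intro mult_right_mono) auto
  ultimately have "n + 1 < n ^ m"
    using n by linarith
  then have p1: "(n + 1) * p < 1"
    using n by (simp add: p n_def[symmetric] field_simps)
  have lo: "\<phi> x = n * x" if "x \<le> p" for x
  proof -
    have "(n - 1) * x \<le> (n - 1) * p" "(n + 1) * x \<le> (n + 1) * p"
      using that n by (auto intro!: mult_left_mono)
    then have "(n - 1) * x \<le> (n - 1) * p" "(n + 1) * x \<le> 1"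
      using p1 by linarith+
    moreover from this(2) have "(n - 1) * ((n + 1) * x) \<le> (n - 1) * 1"
      using n by (intro mult_left_mono) auto
    ultimately show ?thesis
      using n by (auto simp: \<phi>_def min_def field_simps)
  qed
  have mid: "\<phi> x = x + (n - 1) * p" if "p \<le> x" "x \<le> 1 - n * p" for x
  proof -
    have "(n - 1) * p \<le> (n - 1) * x" "(n - 1) * (n * p) \<le> (n - 1) * (1 - x)"
      using that n by (auto intro!: mult_left_mono)
    then show ?thesis
      using n by (auto simp: \<phi>_def min_def field_simps)
  qed
  have hi: "\<phi> x = 1 - (1 - x) / n" if "1 - n * p \<le> x" for x
  proof -
    have 1: "(n - 1) * (1 - x) \<le> (n - 1) * (n * p)"
      using that n by (auto intro!: mult_left_mono)
    then have a: "1 - (1 - x) / n \<le> x + (n - 1) * p"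
      using n by (simp add: field_simps)
    have "p \<le> x"
      using that p1 by (simp add: algebra_simps)
    then have "(n - 1) * p \<le> (n - 1) * x"
      using n by (auto intro!: mult_left_mono)
    then have "x + (n - 1) * p \<le> n * x"
      by (simp add: algebra_simps)
    with a show ?thesis
      by (auto simp: \<phi>_def min_def)
  qed
  have mono: "\<phi> x < \<phi> y" if "x < y" for x y
  proof -
    have "n * x < n * y" "(1 - y) / n < (1 - x) / n"
      using n that by (auto simp: divide_strict_right_mono)
    then show ?thesis
      using that by (auto simp: \<phi>_def min_def)
  qed
  have \<phi>0: "\<phi> 0 = 0" and \<phi>1: "\<phi> 1 = 1"
    using lo[of 0] hi[of 1] n p0 by auto
  have cont: "continuous_on {0..1} \<phi>"
    unfolding \<phi>_def using n by (intro continuous_intros) auto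
  have "\<phi> ` {0..1} \<subseteq> {0..1}"
  proof
    fix y assume "y \<in> \<phi> ` {0..1}"
    then obtain x where "x \<in> {0..1}" "y = \<phi> x"
      by auto
    then show "y \<in> {0..1}"
      using mono[of 0 x] mono[of x 1] \<phi>0 \<phi>1 by (cases "x = 0"; cases "x = 1") auto
  qed
  moreover have "y \<in> \<phi> ` {0..1}" if y: "y \<in> {0..1}" for y
  proof -
    have "\<exists>x\<ge>0. x \<le> 1 \<and> \<phi> x = y"
      using y \<phi>0 \<phi>1 cont by (intro IVT') auto
    then show ?thesis
      by auto
  qed
  ultimately have im: "\<phi> ` {0..1} = {0..1}"
    by auto
  have "inj_on \<phi> {0..1}"
    by (intro linorder_inj_onI) (use mono in \<open>force+\<close>)
  then obtain g where g: "homeomorphism {0..1} {0..1} \<phi> g"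
    using homeomorphism_compact[OF _ cont im] by auto
  have p_nadic: "p \<in> nadic_rationals N"
    unfolding nadic_rationals_def p by (rule CollectI, rule exI[of _ 1], rule exI[of _ "int m"]) simp
  have np_nadic: "n * p \<in> nadic_rationals N"
    using nadic_rationals_mult_powi[OF _ p_nadic, of 1] N by (simp add: n_def)
  have one: "1 \<in> nadic_rationals N" and zero: "0 \<in> nadic_rationals N"
    using nadic_rationals_of_int[of 1 N] nadic_rationals_of_int[of 0 N] by auto
  have f: "restrict \<phi> {0..1} \<in> thompson_F N"
  proof (rule thompson_FI)
    show "\<exists>g. homeomorphism {0..1} {0..1} (restrict \<phi> {0..1}) g"
      using homeomorphism_restrict[OF g] by blast
    have "\<exists>k::int. \<exists>c\<in>nadic_rationals N. \<forall>x\<in>{u..v}. restrict \<phi> {0..1} x = real N powi k * x + c"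
      if uv: "0 \<le> u" "u < v" "v \<le> 1" "{u<..<v} \<inter> {p, 1 - n * p} = {}" for u v
    proof -
      have "p < 1 - n * p"
        using p1 by (simp add: algebra_simps)
      with uv consider "v \<le> p" | "p \<le> u" "v \<le> 1 - n * p" | "1 - n * p \<le> u"
        by fastforce
      then show ?thesis
      proof cases
        case 1
        then have "\<forall>x\<in>{u..v}. restrict \<phi> {0..1} x = real N powi 1 * x + 0"
          using lo uv by (auto simp: n_def)
        then show ?thesis
          using zero by blast
      next
        case 2
        then have "\<forall>x\<in>{u..v}. restrict \<phi> {0..1} x = real N powi 0 * x + (n * p - p)"
          using mid uv by (auto simp: algebra_simps)
        moreover have "n * p - p \<in> nadic_rationals N"
          using np_nadic p_nadic N by (intro nadic_rationals_diff) auto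
        ultimately show ?thesis
          by blast
      next
        case 3
        have "restrict \<phi> {0..1} x = real N powi (- 1) * x + (1 - real N powi (- 1) * 1)"
          if "x \<in> {u..v}" for x
          using hi[of x] uv 3 n that by (simp add: n_def field_simps)
        moreover have "1 - real N powi (- 1) * 1 \<in> nadic_rationals N"
          using one N by (intro nadic_rationals_diff nadic_rationals_mult_powi) auto
        ultimately show ?thesis
          by blast
      qed
    qed
    moreover have "1 - n * p \<in> nadic_rationals N"
      using one np_nadic N by (intro nadic_rationals_diff) auto
    ultimately show "nadic_pieces N (restrict \<phi> {0..1}) {p, 1 - n * p}"
      unfolding nadic_pieces_def using p_nadic by blast
  qed auto
  have "0 \<le> n * p"
    using n p0 by simp
  then have "0 \<le> x" "x \<le> 1"
    using x p0 unfolding n_def by linarith+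
  then have x01: "x \<in> {0..1}"
    by simp
  then have "\<phi> x \<in> {0..1}"
    using im by blast
  moreover have "\<phi> x = x + (real N - 1) * p"
    using mid x by (simp add: n_def)
  moreover have "restrict \<phi> {0..1} x = \<phi> x"
    using x01 by simp
  ultimately show ?thesis
    using x01 f unfolding thompson_orbit_rel_def by (intro CollectI case_prodI conjI bexI[OF _ f]) auto
qed

section \<open>Linearity from equal increments\<close>

text \<open>Both \<open>F x\<close> and \<open>x * F 1\<close> are within a multiple of \<open>c + p\<close> of the same multiple of
  the increment \<open>F (p + c) - F p\<close>.\<close>

lemma linear_if_equal_increments:
  fixes F :: "real \<Rightarrow> real"
  assumes lip: "\<And>x y. 0 \<le> x \<Longrightarrow> x \<le> y \<Longrightarrow> y \<le> 1 \<Longrightarrow> \<bar>F y - F x\<bar> \<le> y - x"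
    and F0: "F 0 = 0"
    and inc: "\<And>e. e > 0 \<Longrightarrow> \<exists>c p. 0 < c \<and> c \<le> e \<and> 0 < p \<and> p \<le> e \<and>
      (\<forall>x. p \<le> x \<longrightarrow> x + 2 * c \<le> 1 - p \<longrightarrow> F (x + 2 * c) - F (x + c) = F (x + c) - F x)"
    and x: "x \<in> {0..1}"
  shows "F x = x * F 1"
proof -
  have approx: "\<bar>F x - x * F 1\<bar> \<le> e" if "e > 0" for e
  proof -
    \<comment> \<open>The final estimate adds two errors of size \<open>2 * p + c\<close> and one of
      size \<open>c\<close>, in total at most \<open>7 * \<delta>\<close>. The bound
      \<open>1 / 4\<close> keeps \<open>1 - 2 * p\<close> positive and \<open>p + c\<close> inside
      the unit interval.\<close>
    define \<delta> where "\<delta> = min (e / 7) (1 / 4)"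
    have \<delta>: "\<delta> > 0" "7 * \<delta> \<le> e" "\<delta> \<le> 1 / 4"
      using that by (auto simp: \<delta>_def)
    obtain c p where c: "0 < c" "c \<le> \<delta>" and p: "0 < p" "p \<le> \<delta>"
      and inc': "\<And>x. p \<le> x \<Longrightarrow> x + 2 * c \<le> 1 - p \<Longrightarrow> F (x + 2 * c) - F (x + c) = F (x + c) - F x"
      using inc[OF \<delta>(1)] by metis
    define K where "K = F (p + c) - F p"
    have step: "F (p + real (Suc j) * c) - F (p + real j * c) = K"
      if "p + real (Suc j) * c \<le> 1 - p" for j
      using that
    proof (induction j)
      case 0
      then show ?case by (simp add: K_def)
    next
      case (Suc j)
      have "F (p + real j * c + 2 * c) - F (p + real j * c + c) = F (p + real j * c + c) - F (p + real j * c)"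
        using Suc.prems c by (intro inc') (auto simp: algebra_simps)
      moreover have "F (p + real (Suc j) * c) - F (p + real j * c) = K"
        using Suc.prems c by (intro Suc.IH) (auto simp: algebra_simps)
      ultimately show ?case
        by (simp add: algebra_simps)
    qed
    have sum: "F (p + real j * c) = F p + real j * K" if "p + real j * c \<le> 1 - p" for j
      using that
    proof (induction j)
      case (Suc j)
      have "F (p + real j * c) = F p + real j * K"
        using Suc.prems c by (intro Suc.IH) (auto simp: algebra_simps)
      then show ?case
        using step[OF Suc.prems] by (simp add: algebra_simps)
    qed simp
    \<comment> \<open>The number of whole steps of length \<open>c\<close> that fit into
      \<open>t * (1 - 2 * p)\<close>. The scaling keeps the grid point \<open>p + j t * c\<close>
      below \<open>1 - p\<close>, where equal increments are available.\<close>
    define j where "j t = nat \<lfloor>t * (1 - 2 * p) / c\<rfloor>" for t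
    have j: "real (j t) * c \<le> t * (1 - 2 * p)" "t * (1 - 2 * p) < real (j t) * c + c"
      if t: "t \<in> {0..1}" for t
    proof -
      have "0 \<le> t * (1 - 2 * p) / c"
        using t c p \<delta> by simp
      then have "real (j t) \<le> t * (1 - 2 * p) / c" "t * (1 - 2 * p) / c < real (j t) + 1"
        unfolding j_def by linarith+
      then show "real (j t) * c \<le> t * (1 - 2 * p)" "t * (1 - 2 * p) < real (j t) * c + c"
        using c by (simp_all add: field_simps)
    qed
    \<comment> \<open>The error is at most \<open>p\<close> for dropping \<open>F p\<close> and at
      most \<open>p + c\<close> for moving from the grid point to \<open>t\<close>, by the Lipschitz
      bound.\<close>
    have near: "\<bar>F t - real (j t) * K\<bar> \<le> 2 * p + c" if t: "t \<in> {0..1}" for t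
    proof -
      let ?s = "p + real (j t) * c"
      have tp: "0 \<le> t * p" "t * p \<le> p"
        using t p by (auto intro: mult_left_le_one_le)
      have "t * (1 - 2 * p) \<le> 1 * (1 - 2 * p)"
        using t p \<delta> by (intro mult_right_mono) auto
      then have s: "?s \<le> 1 - p"
        using j(1)[OF t] by simp
      have "t * (1 - 2 * p) = t - 2 * (t * p)"
        by (simp add: algebra_simps)
      then have "\<bar>?s - t\<bar> \<le> p + c"
        using j[OF t] tp c p by linarith
      moreover have "\<bar>F ?s - F t\<bar> \<le> \<bar>?s - t\<bar>"
        using lip[of ?s t] lip[of t ?s] t s c p by (cases "?s \<le> t") (auto simp: abs_minus_commute)
      moreover have "\<bar>F p - F 0\<bar> \<le> p"
        using lip[of 0 p] p \<delta> by simp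
      ultimately show ?thesis
        using sum[OF s] F0 by simp
    qed
    have one: "(1::real) \<in> {0..1}"
      by simp
    \<comment> \<open>Both \<open>j x * c\<close> and \<open>x * (j 1 * c)\<close> fall short of
      \<open>x * (1 - 2 * p)\<close> by a rounding error between \<open>0\<close> and
      \<open>c\<close>. Hence \<open>j x\<close> and \<open>x * j 1\<close> differ by at most one
      step, and \<open>\<bar>K\<bar> \<le> c\<close>.\<close>
    have "\<bar>real (j x) * c - x * (real (j 1) * c)\<bar> \<le> c"
    proof -
      have "x * (real (j 1) * c) \<le> x * (1 - 2 * p)"
        using j(1)[OF one] x by (intro mult_left_mono) auto
      moreover have "x * (1 - 2 * p) \<le> x * (real (j 1) * c + c)"
        using j(2)[OF one] x by (intro mult_left_mono) auto
      moreover have "x * c \<le> c"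
        using x c by (intro mult_left_le_one_le) auto
      moreover have "x * (real (j 1) * c + c) = x * (real (j 1) * c) + x * c"
        by (simp add: algebra_simps)
      ultimately show ?thesis
        using j[OF x] by linarith
    qed
    moreover have "\<bar>real (j x) - x * real (j 1)\<bar> * c = \<bar>(real (j x) - x * real (j 1)) * c\<bar>"
      using c by (simp add: abs_mult)
    ultimately have "\<bar>real (j x) - x * real (j 1)\<bar> * c \<le> 1 * c"
      by (simp add: left_diff_distrib mult.assoc)
    then have "\<bar>real (j x) - x * real (j 1)\<bar> \<le> 1"
      using c by (simp only: mult_le_cancel_right_pos)
    then have "\<bar>real (j x) - x * real (j 1)\<bar> * \<bar>K\<bar> \<le> 1 * c"
      using lip[of p "p + c"] c p \<delta> by (intro mult_mono) (auto simp: K_def)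
    moreover have "\<bar>real (j x) * K - x * (real (j 1) * K)\<bar> = \<bar>real (j x) - x * real (j 1)\<bar> * \<bar>K\<bar>"
      unfolding abs_mult[symmetric] by (simp add: left_diff_distrib mult.assoc)
    ultimately have 1: "\<bar>real (j x) * K - x * (real (j 1) * K)\<bar> \<le> c"
      by simp
    have "\<bar>x\<bar> * \<bar>F 1 - real (j 1) * K\<bar> \<le> 1 * (2 * p + c)"
      using near[OF one] x c p by (intro mult_mono) auto
    then have 2: "\<bar>x * F 1 - x * (real (j 1) * K)\<bar> \<le> 2 * p + c"
      unfolding abs_mult[symmetric] by (simp add: right_diff_distrib)
    show ?thesis
      using near[OF x] 1 2 c p \<delta> by linarith
  qed
  show ?thesis
    using approx[of "\<bar>F x - x * F 1\<bar> / 2"] by (cases "F x = x * F 1") auto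
qed

section \<open>Saturated Borel sets have measure zero or one\<close>

lemma measure_translated_piece:
  fixes A :: "real set"
  assumes A: "A \<in> sets borel"
    and inv: "\<And>z. x < z \<Longrightarrow> z \<le> y \<Longrightarrow> z \<in> A \<longleftrightarrow> z + c \<in> A"
  shows "measure lborel (A \<inter> {x + c<..y + c}) = measure lborel (A \<inter> {x<..y})"
proof -
  have "A \<inter> {x + c<..y + c} = (+) c ` (A \<inter> {x<..y})"
  proof (intro equalityI subsetI)
    fix w assume "w \<in> A \<inter> {x + c<..y + c}"
    then have "w - c \<in> A \<inter> {x<..y}"
      using inv[of "w - c"] by auto
    then show "w \<in> (+) c ` (A \<inter> {x<..y})"
      by (intro image_eqI[of _ _ "w - c"]) auto
  next
    fix w assume "w \<in> (+) c ` (A \<inter> {x<..y})"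
    then show "w \<in> A \<inter> {x + c<..y + c}"
      using inv by (auto simp: add.commute)
  qed
  \<comment> \<open>Translation invariance is applied to \<open>lebesgue\<close>, which agrees with
    \<open>lborel\<close> on the Borel sets in question.\<close>
  then have "measure lebesgue (A \<inter> {x + c<..y + c}) = measure lebesgue (A \<inter> {x<..y})"
    by (simp add: measure_translation)
  then show ?thesis
    using A by (simp add: measure_completion)
qed

lemma ergodic_thompson_orbit_rel:
  assumes N: "N \<ge> 2"
  shows "ergodic_rel unit_lebesgue (thompson_orbit_rel N)"
  unfolding ergodic_rel_def
proof (intro ballI impI)
  let ?R = "thompson_orbit_rel N"
  fix A :: "real set" assume "A \<in> sets unit_lebesgue" and "\<exists>C\<subseteq>space unit_lebesgue // ?R. A = \<Union>C"
  then obtain C where C: "C \<subseteq> {0..1} // ?R" "A = \<Union>C"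
    by (auto simp: unit_lebesgue_def space_restrict_space)
  have A: "A \<in> sets borel" "A \<subseteq> {0..1}"
    using \<open>A \<in> sets unit_lebesgue\<close> by (auto simp: unit_lebesgue_def sets_restrict_space_iff)
  note eq = equiv_thompson_orbit_rel[OF N]
  have saturated: "x \<in> A \<longleftrightarrow> y \<in> A" if "(x, y) \<in> ?R" for x y
  proof -
    have "y \<in> A" if "x \<in> A" "(x, y) \<in> ?R" for x y
      using that C in_quotient_imp_closed[OF eq] by blast
    moreover have "(y, x) \<in> ?R"
      using eq that by (meson equivE symD)
    ultimately show ?thesis
      using that by blast
  qed
  have "emeasure lborel A \<le> emeasure lborel {0..1::real}"
    using A by (intro emeasure_mono) auto
  then have fin: "emeasure lborel (A \<inter> B) \<noteq> \<infinity>" for B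
    using emeasure_mono[of "A \<inter> B" A lborel] A(1) by (auto simp: top_unique)
  define F where "F x = measure lborel (A \<inter> {..x})" for x
  have F_diff: "F y - F x = measure lborel (A \<inter> {x<..y})" if "x \<le> y" for x y
  proof -
    have "A \<inter> {..y} = (A \<inter> {..x}) \<union> (A \<inter> {x<..y})"
      using that by auto
    then have "F y = F x + measure lborel (A \<inter> {x<..y})"
      unfolding F_def using A fin by (simp only:) (intro measure_Union, auto)
    then show ?thesis by simp
  qed
  define a where "a = F 1"
  have lin: "F x = x * F 1" if "x \<in> {0..1}" for x
  proof (rule linear_if_equal_increments[OF _ _ _ that])
    fix x y :: real assume "0 \<le> x" "x \<le> y" "y \<le> 1"
    have "measure lborel (A \<inter> {x<..y}) \<le> measure lborel {x<..y}"
      using A \<open>x \<le> y\<close> by (intro measure_mono_fmeasurable) (auto simp: fmeasurable_def)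
    then show "\<bar>F y - F x\<bar> \<le> y - x"
      using F_diff[OF \<open>x \<le> y\<close>] \<open>x \<le> y\<close> by simp
  next
    have "A \<inter> {..0} \<subseteq> {0}"
      using A by auto
    then have "A \<inter> {..0} = {} \<or> A \<inter> {..0} = {0}"
      by (rule subset_singletonD)
    then show "F 0 = 0"
      unfolding F_def by (elim disjE) simp_all
  next
    fix e :: real assume e: "e > 0"
    have "(\<lambda>m. 1 / real N ^ m) \<longlonglongrightarrow> 0"
      using N LIMSEQ_inverse_realpow_zero[of "real N"] by (simp add: divide_inverse)
    \<comment> \<open>The bound is \<open>e / N\<close> because \<open>c + p = N * p\<close> and
      both \<open>c\<close> and \<open>p\<close> have to stay below \<open>e\<close>.\<close>
    then have "\<forall>\<^sub>F m in sequentially. 1 / real N ^ m < e / real N"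
      using e N by (intro order_tendstoD) auto
    then have "\<forall>\<^sub>F m in sequentially. 1 / real N ^ m < e / real N \<and> m \<ge> 2"
      using eventually_ge_at_top[of 2] by eventually_elim auto
    then obtain m where m: "1 / real N ^ m < e / real N" "m \<ge> 2"
      by (auto simp: eventually_sequentially)
    define p c where "p = 1 / real N ^ m" and "c = (real N - 1) * p"
    have p: "p > 0"
      using N by (simp add: p_def)
    have "real N * p < e"
      using m(1) N by (simp add: p_def field_simps)
    moreover have "real N * p = c + p"
      by (simp add: c_def algebra_simps)
    moreover have c: "0 < c"
      using N p by (simp add: c_def)
    moreover have "F (x + 2 * c) - F (x + c) = F (x + c) - F x" if x: "p \<le> x" "x + 2 * c \<le> 1 - p" for x
    proof -
      have "measure lborel (A \<inter> {x + c<..(x + c) + c}) = measure lborel (A \<inter> {x<..x + c})"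
      proof (rule measure_translated_piece[OF A(1)])
        fix z assume "x < z" "z \<le> x + c"
        \<comment> \<open>From \<open>x + 2 * c \<le> 1 - p\<close> one gets
          \<open>x + c \<le> 1 - (c + p) = 1 - N * p\<close>, so \<open>z\<close> lies where the
          group element is a translation by \<open>c\<close>.\<close>
        then have "p \<le> z" "z \<le> 1 - real N * p"
          using x \<open>real N * p = c + p\<close> by auto
        then show "z \<in> A \<longleftrightarrow> z + c \<in> A"
          unfolding c_def using thompson_orbit_rel_translation[OF N m(2) p_def] saturated by blast
      qed
      then show ?thesis
        using F_diff[of x "x + c"] F_diff[of "x + c" "x + 2 * c"] c by (simp add: algebra_simps)
    qed
    ultimately show "\<exists>c p. 0 < c \<and> c \<le> e \<and> 0 < p \<and> p \<le> e \<and>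
      (\<forall>x. p \<le> x \<longrightarrow> x + 2 * c \<le> 1 - p \<longrightarrow> F (x + 2 * c) - F (x + c) = F (x + c) - F x)"
      using p by (intro exI[of _ c] exI[of _ p]) auto
  qed
  have a0: "0 \<le> a"
    by (simp add: a_def F_def)
  have "A \<inter> {..1} = A"
    using A by auto
  then have emA: "emeasure lborel A = ennreal a"
    using fin[of "{..1}"] by (simp add: a_def F_def emeasure_eq_ennreal_measure)
  \<comment> \<open>\<open>M1\<close> is Lebesgue measure restricted to \<open>A\<close>, and
    \<open>M2\<close> is \<open>a\<close> times Lebesgue measure on the unit interval. Their
    equality says that \<open>A\<close> is independent of every Borel set.\<close>
  define M1 where "M1 = density lborel (indicator A)"
  define M2 where "M2 = density lborel (\<lambda>x::real. ennreal a * indicator {0..1} x)"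
  have M1: "emeasure M1 B = emeasure lborel (A \<inter> B)" if "B \<in> sets borel" for B
    using that A by (simp add: M1_def emeasure_density flip: indicator_inter_arith)
  have M2: "emeasure M2 B = ennreal a * emeasure lborel ({0..1} \<inter> B)" if "B \<in> sets borel" for B
  proof -
    have "emeasure M2 B = (\<integral>\<^sup>+x. ennreal a * indicator ({0..1} \<inter> B) x \<partial>lborel)"
      unfolding M2_def using that
      by (subst emeasure_density) (auto simp: indicator_inter_arith mult.assoc)
    also have "\<dots> = ennreal a * emeasure lborel ({0..1} \<inter> B)"
      using that by (intro nn_integral_cmult_indicator) auto
    finally show ?thesis .
  qed
  \<comment> \<open>Agreement on the half-lines \<open>{x<..}\<close>, with finite values there,
    determines a Borel measure. For \<open>x\<close> in the unit interval both values are
    \<open>a * (1 - x)\<close>, by linearity of \<open>F\<close>.\<close>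
  have "M1 = M2"
  proof (rule measure_eqI_lessThan)
    show "sets M1 = sets borel" "sets M2 = sets borel"
      by (simp_all add: M1_def M2_def)
    fix x :: real
    show "emeasure M1 {x<..} < \<infinity>"
      using fin[of "{x<..}"] by (simp add: M1 less_top)
    consider "x < 0" | "x \<in> {0..1}" | "x > 1"
      by force
    then show "emeasure M1 {x<..} = emeasure M2 {x<..}"
    proof cases
      case 1
      then have "A \<inter> {x<..} = A" "{0..1} \<inter> {x<..} = {0..1}"
        using A by auto
      then show ?thesis
        by (simp add: M1 M2 emA)
    next
      case 2
      have "A \<inter> {x<..} = A \<inter> {x<..1}" "{0..1} \<inter> {x<..} = {x<..1}"
        using A 2 by auto
      then have "emeasure M1 {x<..} = ennreal (measure lborel (A \<inter> {x<..1}))"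
        "emeasure M2 {x<..} = ennreal a * ennreal (1 - x)"
        using 2 fin[of "{x<..1}"] emeasure_eq_ennreal_measure[of lborel "A \<inter> {x<..1}"]
        by (simp_all add: M1 M2)
      moreover have "measure lborel (A \<inter> {x<..1}) = a * (1 - x)"
        using F_diff[of x 1] lin[OF 2] 2 by (simp add: a_def algebra_simps)
      ultimately show ?thesis
        using a0 2 by (simp add: ennreal_mult)
    next
      case 3
      then have "A \<inter> {x<..} = {}" "{0..1} \<inter> {x<..} = {}"
        using A by auto
      then show ?thesis
        by (simp add: M1 M2)
    qed
  qed
  \<comment> \<open>Testing independence of \<open>A\<close> from itself gives
    \<open>a = a * a\<close>.\<close>
  then have "emeasure lborel (A \<inter> A) = ennreal a * emeasure lborel ({0..1} \<inter> A)"
    using M1[OF A(1)] M2[OF A(1)] by simp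
  moreover have "{0..1} \<inter> A = A"
    using A by auto
  ultimately have "ennreal a = ennreal (a * a)"
    using a0 by (simp add: emA ennreal_mult)
  then have "a = 0 \<or> a = 1"
    using a0 by simp
  moreover have "emeasure unit_lebesgue A = ennreal a"
    using A emA by (simp add: unit_lebesgue_def emeasure_restrict_space)
  ultimately show "emeasure unit_lebesgue A = 0 \<or> emeasure unit_lebesgue A = 1"
    by auto
qed

theorem mainTheorem2:
  fixes N :: nat
  assumes "N \<ge> 2"
  shows "equiv {0..1} (thompson_orbit_rel N) \<and>
         standard_rel unit_lebesgue (thompson_orbit_rel N) \<and>
         quasi_preserving_rel unit_lebesgue (thompson_orbit_rel N) \<and>
         ergodic_rel unit_lebesgue (thompson_orbit_rel N)"
  using assms equiv_thompson_orbit_rel standard_thompson_orbit_rel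
    quasi_preserving_thompson_orbit_rel ergodic_thompson_orbit_rel
  by blast

end
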